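(* Let $z\in\mathbb{C}$ with $z(z^2-1)\neq 0$ and let $\mathfrak{r}_{3,z}$ be the complex Lie algebra on $\mathbb{C}^3$ with canonical basis $\{e_1,e_2,e_3\}$ and nonzero brackets $[e_1,e_2]=e_2$, $[e_1,e_3]=ze_3$. Any hom-Lie algebra $(\mathfrak{r}_{3,z},A)$ with $A$ a nilpotent operator is isomorphic to some hom-Lie algebra $\mathfrak{L}_5^i(z):=(\mathfrak{r}_{3,z},A_i)$, where $A_0$ is the zero map and the matrices of the other $A_i$ with respect to the ordered basis $\{e_1,e_2,e_3\}$ are $$A_1=\begin{pmatrix}0&0&0\\1&0&0\\0&0&0\end{pmatrix},\quad A_2=\begin{pmatrix}0&0&0\\0&0&0\\1&0&0\end{pmatrix},\quad A_3=\begin{pmatrix}0&0&0\\1&0&0\\1&0&0\end{pmatrix},$$ $$A_4=\begin{pmatrix}0&0&0\\0&0&1\\0&0&0\end{pmatrix},\quad A_5=\begin{pmatrix}0&0&0\\0&0&0\\0&1&0\end{pmatrix},\quad A_6(\lambda)=\begin{pmatrix}0&0&0\\0&\lambda&\lambda\\0&-\lambda&-\lambda\end{pmatrix},$$ $$A_7=\begin{pmatrix}0&0&0\\1&0&0\\0&1&0\end{pmatrix},\quad A_8=\begin{pmatrix}0&0&0\\0&0&1\\1&0&0\end{pmatrix},\quad A_9(\lambda)=\begin{pmatrix}0&0&0\\1&\lambda&\lambda\\0&-\lambda&-\lambda\end{pmatrix},$$ with $\lambda\in\mathbb{C}\setminus\{0\}$ in $A_6(\lambda)$ and $A_9(\lambda)$.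 Moreover, two hom-Lie algebras $(\mathfrak{r}_{3,z},A_i)$ and $(\mathfrak{r}_{3,z},A_j)$ in this list (including those with parameter $\lambda$) are isomorphic if and only if their twisting maps are equal, $A_i=A_j$.
   Context: A complex hom-Lie algebra is a triple $(V,\cdot,A)$, where $V$ is a complex vector space, $\cdot$ is a skew-symmetric bilinear product on $V$, and $A:V\to V$ is a linear map (the twisting map) satisfying the hom-Jacobi identity $$\sum_{\sigma\in S_3}\operatorname{sign}(\sigma)\,Ax_{\sigma(1)}\cdot(x_{\sigma(2)}\cdot x_{\sigma(3)})=0\quad\text{for all }x_1,x_2,x_3\in V.$$ For a Lie algebra $\mathfrak{g}$, a hom-Lie algebra $(\mathfrak{g},A)$ is one whose product is the Lie bracket of $\mathfrak{g}$. An isomorphism of hom-Lie algebras $(V,\cdot,A)\to(U,\ast,B)$ is an invertible linear map $g:V\to U$ with $g(x\cdot y)=(gx)\ast(gy)$ for all $x,y\in V$ and $g\circ A=B\circ g$. In the matrix of a linear map, the $j$-th column is the coordinate vector of the image of $e_j$. *)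

theory Defs
  imports "HOL-Analysis.Analysis"
begin

locale hom_lie_algebra = vector_space scale
  for scale :: "complex \<Rightarrow> 'v::ab_group_add \<Rightarrow> 'v" +
  fixes prd :: "'v \<Rightarrow> 'v \<Rightarrow> 'v"
    and twist :: "'v \<Rightarrow> 'v"
  assumes linear_left: "Vector_Spaces.linear scale scale (\<lambda>x. prd x y)"
    and linear_right: "Vector_Spaces.linear scale scale (\<lambda>y. prd x y)"
    and skew_symmetric: "prd x y = - prd y x"
    and linear_twist: "Vector_Spaces.linear scale scale twist"
    and hom_Jacobi:
      "\<And>x :: nat \<Rightarrow> 'v.
        (\<Sum>\<sigma> | \<sigma> permutes {1, 2, 3}.
          scale (of_int (sign \<sigma>)) (prd (twist (x (\<sigma> 1))) (prd (x (\<sigma> 2)) (x (\<sigma> 3))))) = 0"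

definition hom_lie_isomorphic ::
  "(complex \<Rightarrow> 'v::ab_group_add \<Rightarrow> 'v) \<Rightarrow> ('v \<Rightarrow> 'v \<Rightarrow> 'v) \<Rightarrow> ('v \<Rightarrow> 'v) \<Rightarrow>
   (complex \<Rightarrow> 'u::ab_group_add \<Rightarrow> 'u) \<Rightarrow> ('u \<Rightarrow> 'u \<Rightarrow> 'u) \<Rightarrow> ('u \<Rightarrow> 'u) \<Rightarrow> bool" where
  "hom_lie_isomorphic scaleV prdV A scaleU prdU B \<longleftrightarrow>
    (\<exists>g. Vector_Spaces.linear scaleV scaleU g \<and> bij g \<and>
      (\<forall>x y. g (prdV x y) = prdU (g x) (g y)) \<and> g \<circ> A = B \<circ> g)"

definition nilpotent_operator :: "('v::zero \<Rightarrow> 'v) \<Rightarrow> bool" where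
  "nilpotent_operator A \<longleftrightarrow> (\<exists>k. \<forall>x. (A ^^ k) x = 0)"

text \<open>
  The bilinear skew-symmetric extension of the brackets of basis vectors; see
  the lemmas below. The canonical basis vectors are \<open>axis 1 1\<close>, \<open>axis 2 1\<close>, \<open>axis 3 1\<close>.
\<close>

definition r3_bracket :: "complex \<Rightarrow> complex^3 \<Rightarrow> complex^3 \<Rightarrow> complex^3" where
  "r3_bracket z x y =
    vector [0, x$1 * y$2 - x$2 * y$1, z * (x$1 * y$3 - x$3 * y$1)]"

lemma r3_bracket_basis:
  "r3_bracket z (axis 1 1) (axis 2 1) = axis 2 1"
  "r3_bracket z (axis 1 1) (axis 3 1) = z *s axis 3 1"
  "r3_bracket z (axis 2 1) (axis 3 1) = 0"
  by (simp_all add: r3_bracket_def vec_eq_iff forall_3 axis_def)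

lemma linear_r3_bracket:
  "Vector_Spaces.linear (*s) (*s) (\<lambda>x. r3_bracket z x y)"
  "Vector_Spaces.linear (*s) (*s) (\<lambda>y. r3_bracket z x y)"
  by (unfold_locales; simp add: r3_bracket_def vec_eq_iff forall_3 algebra_simps)+

lemma r3_bracket_skew: "r3_bracket z x y = - r3_bracket z y x"
  by (simp add: r3_bracket_def vec_eq_iff forall_3 algebra_simps)

lemma r3_bracket_Jacobi:
  "r3_bracket z x (r3_bracket z y w) + r3_bracket z y (r3_bracket z w x)
    + r3_bracket z w (r3_bracket z x y) = 0"
  by (simp add: r3_bracket_def vec_eq_iff forall_3 algebra_simps)

definition A1 :: "complex^3^3" where
  "A1 = vector [vector [0, 0, 0], vector [1, 0, 0], vector [0, 0, 0]]"

definition A2 :: "complex^3^3" where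
  "A2 = vector [vector [0, 0, 0], vector [0, 0, 0], vector [1, 0, 0]]"

definition A3 :: "complex^3^3" where
  "A3 = vector [vector [0, 0, 0], vector [1, 0, 0], vector [1, 0, 0]]"

definition A4 :: "complex^3^3" where
  "A4 = vector [vector [0, 0, 0], vector [0, 0, 1], vector [0, 0, 0]]"

definition A5 :: "complex^3^3" where
  "A5 = vector [vector [0, 0, 0], vector [0, 0, 0], vector [0, 1, 0]]"

definition A6 :: "complex \<Rightarrow> complex^3^3" where
  "A6 l = vector [vector [0, 0, 0], vector [0, l, l], vector [0, - l, - l]]"

definition A7 :: "complex^3^3" where
  "A7 = vector [vector [0, 0, 0], vector [1, 0, 0], vector [0, 1, 0]]"

definition A8 :: "complex^3^3" where
  "A8 = vector [vector [0, 0, 0], vector [0, 0, 1], vector [1, 0, 0]]"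

definition A9 :: "complex \<Rightarrow> complex^3^3" where
  "A9 l = vector [vector [0, 0, 0], vector [1, l, l], vector [0, - l, - l]]"

definition twist_matrices :: "(complex^3^3) set" where
  "twist_matrices =
    {0, A1, A2, A3, A4, A5, A7, A8} \<union> {A6 l | l. l \<noteq> 0} \<union> {A9 l | l. l \<noteq> 0}"

end

theory Submission imports Defs
begin

text \<open>
  The classification is an orbit computation for small matrices. The hom-Jacobi expression is
  alternating in its three arguments, so it suffices to evaluate it on the canonical basis. There it
  equals a nonzero multiple of \<open>M\<^sub>1\<^sub>3 e\<^sub>2 - z\<^sup>2 M\<^sub>1\<^sub>2 e\<^sub>3\<close>, where \<open>M\<close> is the matrix of the twisting map.
  Hence \<open>M\<close> is a twisting map exactly if its first row is \<open>(M\<^sub>1\<^sub>1, 0, 0)\<close> (\<open>hom_lie_r3_iff\<close>). If \<open>M\<close> is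
  moreover nilpotent, then \<open>M\<^sub>1\<^sub>1 = 0\<close> and the lower right block \<open>B\<close> is a nilpotent \<open>2 \<times> 2\<close> matrix, that
  is, of trace and determinant zero (\<open>nilpotent_r3_twist\<close>). What is left of \<open>M\<close> is the block \<open>B\<close> and a
  column vector \<open>w = (u, v)\<close> to the left of it.

  An automorphism of the Lie algebra preserves the derived algebra \<open>\<langle>e\<^sub>2, e\<^sub>3\<rangle>\<close>. If it sends \<open>e\<^sub>1\<close> to
  \<open>\<mu> e\<^sub>1\<close> plus an element of that plane, then comparing the action of \<open>e\<^sub>1\<close> on the plane before and
  after gives \<open>{1, z} = {\<mu>, \<mu> z}\<close>; since \<open>z\<^sup>2 \<noteq> 1\<close>, this forces \<open>\<mu> = 1\<close>, and then the automorphism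
  preserves the two eigenlines \<open>\<langle>e\<^sub>2\<rangle>\<close> and \<open>\<langle>e\<^sub>3\<rangle>\<close> (\<open>r3_automorphism_iff\<close>). So
  automorphisms are given by an arbitrary translation vector and an invertible diagonal matrix
  \<open>D = diag(p, q)\<close>. Conjugation replaces \<open>B\<close> by \<open>D B D\<^sup>-\<^sup>1\<close> and \<open>w\<close> by \<open>D w\<close> modulo the image of the new
  block (\<open>hom_lie_isomorphic_r3_twist_iff\<close>).

  Diagonal conjugation brings a nilpotent block to exactly one of four shapes: zero, one of the
  two elementary off-diagonal matrices, or the one with rows \<open>(a, a)\<close> and \<open>(-a, -a)\<close> for a unique
  \<open>a \<noteq> 0\<close>. For a fixed shape the only freedom left in \<open>w\<close> is its class modulo the image of \<open>B\<close>, up to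
  nonzero scalars, and each coordinate of that class can be normalised to \<open>0\<close> or \<open>1\<close>. This is the
  list of twisting maps (\<open>twist_matrices_eq\<close>), and it shows both that every orbit meets the list
  (\<open>isomorphic_to_normal_parameters\<close>) and that it does so only once (\<open>normal_parameters_unique\<close>).
\<close>

section \<open>Twisting maps of \<open>r\<^bsub>3,z\<^esub>\<close>\<close>

text \<open>
  For a skew-symmetric product the terms of \<open>\<sigma>\<close> and of \<open>\<sigma>\<close> followed by swapping the two inner
  arguments coincide, so the sum over six permutations is twice the familiar cyclic sum.
\<close>
lemma hom_Jacobi_sum_cyclic:
  fixes prd :: "complex^'n \<Rightarrow> complex^'n \<Rightarrow> complex^'n" and x :: "nat \<Rightarrow> complex^'n"
  assumes skew: "\<And>u v. prd u v = - prd v u"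
    and linear: "\<And>u. Vector_Spaces.linear (*s) (*s) (prd u)"
  shows "(\<Sum>\<sigma> | \<sigma> permutes {1, 2, 3}.
      of_int (sign \<sigma>) *s prd (twist (x (\<sigma> 1))) (prd (x (\<sigma> 2)) (x (\<sigma> 3)))) =
    2 *s (prd (twist (x 1)) (prd (x 2) (x 3)) + prd (twist (x 2)) (prd (x 3) (x 1))
      + prd (twist (x 3)) (prd (x 1) (x 2)))"
proof -
  have f123: "finite {2::nat, 3}" "1 \<notin> {2::nat, 3}"
    by auto
  have f23: "finite {3::nat}" "2 \<notin> {3::nat}"
    by auto
  have "prd u (prd v w) = - prd u (prd w v)" for u v w
    using skew[of v w] module_hom.neg[OF linear[of u, unfolded Vector_Spaces.linear_iff_module_hom]]
    by simp
  from this[of "twist (x 1)" "x 3" "x 2"] this[of "twist (x 2)" "x 1" "x 3"]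
    this[of "twist (x 3)" "x 2" "x 1"]
  show ?thesis
    unfolding sum_over_permutations_insert[OF f123]
    unfolding sum_over_permutations_insert[OF f23]
    unfolding permutes_sing
    by (simp add: sign_swap_id permutation_swap_id sign_compose sign_id swap_id_eq vec_eq_iff)
qed

text \<open>
  Necessity comes from the basis vectors. For sufficiency, the derived algebra is abelian, so
  \<open>[M x, [y, w]]\<close> depends only on the first coordinate of \<open>M x\<close>, which is \<open>M\<^sub>1\<^sub>1 x\<^sub>1\<close>: the identity reduces
  to a multiple of the ordinary Jacobi identity.
\<close>
lemma hom_lie_r3_iff:
  assumes "z \<noteq> 0"
  shows "hom_lie_algebra (*s) (r3_bracket z) ((*v) M) \<longleftrightarrow> M$1$2 = 0 \<and> M$1$3 = 0"
proof
  assume "hom_lie_algebra (*s) (r3_bracket z) ((*v) M)"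
  then interpret hom_lie_algebra "(*s)" "r3_bracket z" "(*v) M" .
  define x where "x i = (if i = 1 then axis 1 1 else if i = 2 then axis 2 1 else axis 3 1 :: complex^3)"
    for i :: nat
  have "2 *s (r3_bracket z (M *v x 1) (r3_bracket z (x 2) (x 3))
      + r3_bracket z (M *v x 2) (r3_bracket z (x 3) (x 1))
      + r3_bracket z (M *v x 3) (r3_bracket z (x 1) (x 2))) = 0"
    using hom_Jacobi[of x] hom_Jacobi_sum_cyclic[of "r3_bracket z" "(*v) M" x, OF skew_symmetric linear_right]
    by simp
  with assms show "M$1$2 = 0 \<and> M$1$3 = 0"
    by (simp add: x_def r3_bracket_def vec_eq_iff forall_3 matrix_vector_mult_def sum_3 axis_def)
next
  assume M: "M$1$2 = 0 \<and> M$1$3 = 0"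
  show "hom_lie_algebra (*s) (r3_bracket z) ((*v) M)"
  proof (intro hom_lie_algebra.intro hom_lie_algebra_axioms.intro)
    fix x :: "nat \<Rightarrow> complex^3"
    show "(\<Sum>\<sigma> | \<sigma> permutes {1, 2, 3}.
      of_int (sign \<sigma>) *s r3_bracket z (M *v x (\<sigma> 1)) (r3_bracket z (x (\<sigma> 2)) (x (\<sigma> 3)))) = 0"
      unfolding hom_Jacobi_sum_cyclic[of "r3_bracket z" "(*v) M" x, OF r3_bracket_skew linear_r3_bracket(2)]
      using M
      by (simp add: r3_bracket_def vec_eq_iff forall_3 matrix_vector_mult_def sum_3 algebra_simps)
  qed (rule vec.vector_space_axioms linear_r3_bracket r3_bracket_skew matrix_vector_mul_linear_gen)+
qed

definition r3_twist :: "complex \<Rightarrow> complex \<Rightarrow> complex \<Rightarrow> complex \<Rightarrow> complex \<Rightarrow> complex^3^3" where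
  "r3_twist u v a b c = vector [vector [0, 0, 0], vector [u, a, b], vector [v, c, - a]]"

lemma r3_twist_eq_iff [simp]:
  "r3_twist u v a b c = r3_twist u' v' a' b' c' \<longleftrightarrow>
    u = u' \<and> v = v' \<and> a = a' \<and> b = b' \<and> c = c'"
  by (auto simp: r3_twist_def vec_eq_iff forall_3)

lemma nilpotent_eigenvalue:
  fixes M :: "complex^'n^'n"
  assumes nil: "nilpotent_operator ((*v) M)" and eig: "M *v x = r *s x" and "x \<noteq> 0"
  shows "r = 0"
proof -
  have "((*v) M ^^ k) x = r ^ k *s x" for k
    by (induction k) (simp_all add: vec.scale eig mult.commute)
  with nil obtain k where "r ^ k *s x = 0"
    by (metis nilpotent_operator_def)
  with \<open>x \<noteq> 0\<close> show ?thesis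
    by (simp add: vec_eq_iff) (metis power_not_zero)
qed

text \<open>
  A nilpotent block has trace and determinant zero because each root of its characteristic
  polynomial is an eigenvalue of \<open>M\<close>, with an eigenvector in the plane \<open>\<langle>e\<^sub>2, e\<^sub>3\<rangle>\<close>, and must vanish.
\<close>
lemma nilpotent_r3_twist:
  fixes M :: "complex^3^3"
  assumes row: "M$1$2 = 0" "M$1$3 = 0" and nil: "nilpotent_operator ((*v) M)"
  obtains u v a b c where "M = r3_twist u v a b c" "a\<^sup>2 + b * c = 0"
proof -
  define a b c d where "a = M$2$2" "b = M$2$3" "c = M$3$2" "d = M$3$3"
  note abcd = a_b_c_d_def
  have M11: "M$1$1 = 0"
  proof -
    have "(((*v) M ^^ k) (axis 1 1))$1 = M$1$1 ^ k" for k
      by (induction k) (simp_all add: axis_def matrix_vector_mult_def sum_3 row)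
    with nil show ?thesis
      unfolding nilpotent_operator_def by (metis power_eq_0_iff zero_index)
  qed
  have root: "r = 0" if r: "r\<^sup>2 - (a + d) * r + (a * d - b * c) = 0" for r
  proof -
    \<comment> \<open>By the characteristic equation the nonzero columns of the adjugate of the block minus \<open>r\<close>
      are eigenvectors; up to sign they are used here. If both columns vanish, the block is scalar.\<close>
    define x :: "complex^3" where
      "x = (if b \<noteq> 0 \<or> r \<noteq> a then vector [0, b, r - a]
            else if c \<noteq> 0 \<or> r \<noteq> d then vector [0, r - d, c] else axis 2 1)"
    have "M *v x = r *s x"
      using r row M11
      by (auto simp: x_def abcd[symmetric] vec_eq_iff forall_3 matrix_vector_mult_def sum_3 axis_def
          algebra_simps power2_eq_square)
    moreover have "x \<noteq> 0"
      by (auto simp: x_def vec_eq_iff forall_3 axis_def)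
    ultimately show ?thesis
      using nilpotent_eigenvalue nil by blast
  qed
  \<comment> \<open>One root of the characteristic polynomial; its vanishing kills the determinant, after which the
    trace is itself a root.\<close>
  define s where "s = csqrt ((a + d)\<^sup>2 - 4 * (a * d - b * c))"
  have s: "s\<^sup>2 = (a + d)\<^sup>2 - 4 * (a * d - b * c)"
    by (simp add: s_def)
  have "((a + d + s) / 2)\<^sup>2 - (a + d) * ((a + d + s) / 2) + (a * d - b * c)
      = (s\<^sup>2 - ((a + d)\<^sup>2 - 4 * (a * d - b * c))) / 4"
    by (simp add: field_simps power2_eq_square)
  also have "\<dots> = 0"
    unfolding s by simp
  finally have "(a + d + s) / 2 = 0"
    by (rule root)
  then have "(a + d) + s = 0"
    by simp
  then have "s = - (a + d)"
    by (simp only: add_eq_0_iff)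
  from s have det: "a * d - b * c = 0"
    unfolding \<open>s = - (a + d)\<close> power2_minus by simp
  have "a + d = 0"
    by (rule root) (simp add: det power2_eq_square)
  then have d: "d = - a"
    by (simp only: add_eq_0_iff)
  have "M = r3_twist (M$2$1) (M$3$1) a b c"
    using M11 row d by (simp add: r3_twist_def vec_eq_iff forall_3 abcd[symmetric])
  moreover have "a\<^sup>2 + b * c = 0"
    using det unfolding d by algebra
  ultimately show thesis by (rule that)
qed

section \<open>Automorphisms and the orbit equations\<close>

definition r3_aut :: "complex \<Rightarrow> complex \<Rightarrow> complex \<Rightarrow> complex \<Rightarrow> complex^3^3" where
  "r3_aut s t p q = vector [vector [1, 0, 0], vector [s, p, 0], vector [t, 0, q]]"

text \<open>
  With \<open>\<mu> = G\<^sub>1\<^sub>1\<close>, compatibility with the brackets says that the images of \<open>e\<^sub>2\<close> and \<open>e\<^sub>3\<close> are eigenvectors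
  of \<open>\<mu> ad(e\<^sub>1)\<close> for \<open>1\<close> and \<open>z\<close>. If \<open>\<mu> \<noteq> 1\<close>, they would have to swap the lines \<open>\<langle>e\<^sub>2\<rangle>\<close> and
  \<open>\<langle>e\<^sub>3\<rangle>\<close>, which requires \<open>\<mu> = z\<close> and \<open>\<mu> z = 1\<close>, contrary to \<open>z\<^sup>2 \<noteq> 1\<close>.
\<close>
lemma r3_automorphism_iff:
  assumes z: "z * (z\<^sup>2 - 1) \<noteq> 0"
  shows "(bij ((*v) G) \<and> (\<forall>x y. G *v r3_bracket z x y = r3_bracket z (G *v x) (G *v y))) \<longleftrightarrow>
    (\<exists>s t p q. p \<noteq> 0 \<and> q \<noteq> 0 \<and> G = r3_aut s t p q)"
proof
  assume *: "bij ((*v) G) \<and> (\<forall>x y. G *v r3_bracket z x y = r3_bracket z (G *v x) (G *v y))"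
  then have hom: "\<And>x y. G *v r3_bracket z x y = r3_bracket z (G *v x) (G *v y)" and "det G \<noteq> 0"
    by (auto simp: invertible_det_nz[symmetric] invertible_eq_bij)
  have row: "G$1$2 = 0" "G$1$3 = 0"
    and e12: "G$2$2 = G$1$1 * G$2$2" "G$3$2 = z * G$1$1 * G$3$2"
    and e13: "z * G$2$3 = G$1$1 * G$2$3" "z * G$3$3 = z * G$1$1 * G$3$3"
    using hom[of "axis 1 1" "axis 2 1"] hom[of "axis 1 1" "axis 3 1"] z
    by (auto simp: r3_bracket_def vec_eq_iff forall_3 matrix_vector_mult_def sum_3 axis_def mult.commute)
  have "det G = G$1$1 * (G$2$2 * G$3$3 - G$2$3 * G$3$2)"
    by (simp add: det_3 row algebra_simps)
  with \<open>det G \<noteq> 0\<close> have det: "G$1$1 * (G$2$2 * G$3$3 - G$2$3 * G$3$2) \<noteq> 0"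
    by simp
  have "G$1$1 = 1"
  proof (rule ccontr)
    assume "G$1$1 \<noteq> 1"
    with e12(1) have "G$2$2 = 0" by simp
    with det have "G$2$3 \<noteq> 0" "G$3$2 \<noteq> 0" by auto
    with e12(2) e13(1) have "z = G$1$1" "z * G$1$1 = 1" by auto
    with z show False by (simp add: power2_eq_square)
  qed
  moreover have "z \<noteq> 1" "z \<noteq> 0" using z by auto
  ultimately have "G$2$3 = 0" "G$3$2 = 0" using e12(2) e13(1) by auto
  with det row \<open>G$1$1 = 1\<close>
  have "G = r3_aut (G$2$1) (G$3$1) (G$2$2) (G$3$3)" "G$2$2 \<noteq> 0" "G$3$3 \<noteq> 0"
    by (auto simp: r3_aut_def vec_eq_iff forall_3)
  then show "\<exists>s t p q. p \<noteq> 0 \<and> q \<noteq> 0 \<and> G = r3_aut s t p q" by blast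
next
  assume "\<exists>s t p q. p \<noteq> 0 \<and> q \<noteq> 0 \<and> G = r3_aut s t p q"
  then obtain s t p q where "p \<noteq> 0" "q \<noteq> 0" and G: "G = r3_aut s t p q" by blast
  then have "det G \<noteq> 0" by (simp add: det_3 r3_aut_def)
  moreover have "G *v r3_bracket z x y = r3_bracket z (G *v x) (G *v y)" for x y
    by (simp add: G r3_aut_def r3_bracket_def vec_eq_iff forall_3 matrix_vector_mult_def sum_3
        algebra_simps)
  ultimately show "bij ((*v) G) \<and> (\<forall>x y. G *v r3_bracket z x y = r3_bracket z (G *v x) (G *v y))"
    by (simp add: invertible_det_nz[symmetric] invertible_eq_bij)
qed

lemma hom_lie_isomorphic_matrix_iff:
  assumes "z * (z\<^sup>2 - 1) \<noteq> 0"
  shows "hom_lie_isomorphic (*s) (r3_bracket z) ((*v) M) (*s) (r3_bracket z) ((*v) N) \<longleftrightarrow>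
    (\<exists>s t p q. p \<noteq> 0 \<and> q \<noteq> 0 \<and> r3_aut s t p q ** M = N ** r3_aut s t p q)"
proof -
  have comm: "(*v) G \<circ> (*v) M = (*v) N \<circ> (*v) G \<longleftrightarrow> G ** M = N ** G" for G :: "complex^3^3"
    by (simp add: matrix_eq fun_eq_iff matrix_vector_mul_assoc)
  have "hom_lie_isomorphic (*s) (r3_bracket z) ((*v) M) (*s) (r3_bracket z) ((*v) N) \<longleftrightarrow>
    (\<exists>G. (bij ((*v) G) \<and> (\<forall>x y. G *v r3_bracket z x y = r3_bracket z (G *v x) (G *v y)))
       \<and> G ** M = N ** G)" (is "_ \<longleftrightarrow> ?R")
  proof
    assume "hom_lie_isomorphic (*s) (r3_bracket z) ((*v) M) (*s) (r3_bracket z) ((*v) N)"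
    then obtain g where g: "Vector_Spaces.linear (*s) (*s) g" "bij g"
      "\<forall>x y. g (r3_bracket z x y) = r3_bracket z (g x) (g y)" "g \<circ> (*v) M = (*v) N \<circ> g"
      unfolding hom_lie_isomorphic_def by blast
    moreover have "g = (*v) (matrix g)"
      using matrix_works[OF g(1)] by auto
    ultimately show ?R
      using comm by metis
  next
    assume ?R
    then show "hom_lie_isomorphic (*s) (r3_bracket z) ((*v) M) (*s) (r3_bracket z) ((*v) N)"
      unfolding hom_lie_isomorphic_def using comm matrix_vector_mul_linear_gen by blast
  qed
  also have "\<dots> \<longleftrightarrow> (\<exists>s t p q. p \<noteq> 0 \<and> q \<noteq> 0 \<and> r3_aut s t p q ** M = N ** r3_aut s t p q)"
    unfolding r3_automorphism_iff[OF assms] by blast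
  finally show ?thesis .
qed

text \<open>
  The equations compare \<open>D (w | B)\<close> with \<open>(w' + B' (s, t) | B' D)\<close>. In particular the diagonal entry \<open>a\<close>
  of the block is an invariant.
\<close>
lemma hom_lie_isomorphic_r3_twist_iff:
  assumes "z * (z\<^sup>2 - 1) \<noteq> 0"
  shows "hom_lie_isomorphic (*s) (r3_bracket z) ((*v) (r3_twist u v a b c))
      (*s) (r3_bracket z) ((*v) (r3_twist u' v' a' b' c')) \<longleftrightarrow>
    (\<exists>s t p q. p \<noteq> 0 \<and> q \<noteq> 0 \<and> p * u = u' + a' * s + b' * t \<and> q * v = v' + c' * s - a' * t \<and>
      a = a' \<and> p * b = b' * q \<and> q * c = c' * p)"
proof -
  have "r3_aut s t p q ** r3_twist u v a b c = r3_twist u' v' a' b' c' ** r3_aut s t p q \<longleftrightarrow>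
      p * u = u' + a' * s + b' * t \<and> q * v = v' + c' * s - a' * t \<and>
      a = a' \<and> p * b = b' * q \<and> q * c = c' * p" if "p \<noteq> 0" "q \<noteq> 0" for s t p q
    using that
    by (auto simp: r3_aut_def r3_twist_def matrix_matrix_mult_def vec_eq_iff forall_3 sum_3 mult.commute)
  then show ?thesis
    unfolding hom_lie_isomorphic_matrix_iff[OF assms] by blast
qed

section \<open>Normal forms\<close>

text \<open>
  The four alternatives are the shapes of the block. In each of them, a coordinate of \<open>(u, v)\<close>
  that can be removed by adding elements of the image of the block is required to be \<open>0\<close>.
\<close>
definition normal_parameters ::
  "complex \<Rightarrow> complex \<Rightarrow> complex \<Rightarrow> complex \<Rightarrow> complex \<Rightarrow> bool" where
  "normal_parameters u v a b c \<longleftrightarrow>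
    u \<in> {0, 1} \<and> v \<in> {0, 1} \<and>
    (a = 0 \<and> b = 0 \<and> c = 0 \<or> a = 0 \<and> b = 1 \<and> c = 0 \<and> u = 0 \<or>
     a = 0 \<and> b = 0 \<and> c = 1 \<and> v = 0 \<or> a \<noteq> 0 \<and> b = a \<and> c = - a \<and> v = 0)"

lemma twist_matrices_eq:
  "twist_matrices = {r3_twist u v a b c | u v a b c. normal_parameters u v a b c}"
proof -
  have list: "0 = r3_twist 0 0 0 0 0" "A1 = r3_twist 1 0 0 0 0" "A2 = r3_twist 0 1 0 0 0"
    "A3 = r3_twist 1 1 0 0 0" "A4 = r3_twist 0 0 0 1 0" "A5 = r3_twist 0 0 0 0 1"
    "A6 = (\<lambda>l. r3_twist 0 0 l l (- l))" "A7 = r3_twist 1 0 0 0 1" "A8 = r3_twist 0 1 0 1 0"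
    "A9 = (\<lambda>l. r3_twist 1 0 l l (- l))"
    by (auto simp: r3_twist_def A1_def A2_def A3_def A4_def A5_def A6_def A7_def A8_def A9_def
        vec_eq_iff forall_3 fun_eq_iff)
  show ?thesis
    unfolding twist_matrices_def list normal_parameters_def by auto
qed

text \<open>
  The block fixes the ratio \<open>q / p\<close> of the diagonal part unless it is zero, the translation removes the
  component of \<open>(u, v)\<close> along the image of the block, and the remaining overall scale normalises the
  rest to \<open>0\<close> or \<open>1\<close>.
\<close>
lemma isomorphic_to_normal_parameters:
  assumes z: "z * (z\<^sup>2 - 1) \<noteq> 0" and nil: "a\<^sup>2 + b * c = 0"
  shows "\<exists>u' v' a' b' c'. normal_parameters u' v' a' b' c' \<and>
    hom_lie_isomorphic (*s) (r3_bracket z) ((*v) (r3_twist u v a b c))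
      (*s) (r3_bracket z) ((*v) (r3_twist u' v' a' b' c'))"
proof -
  note iso = hom_lie_isomorphic_r3_twist_iff[OF z]
  have scale: "\<exists>p. p \<noteq> 0 \<and> p * x \<in> {0, 1}" for x :: complex
    by (rule exI[of _ "if x = 0 then 1 else 1 / x"]) auto
  consider "a = 0" "b = 0" "c = 0" | "a = 0" "b \<noteq> 0" "c = 0" | "a = 0" "b = 0" "c \<noteq> 0"
    | "a \<noteq> 0" "b \<noteq> 0" using nil by (cases "a = 0"; cases "b = 0") auto
  then show ?thesis
  proof cases
    case 1
    obtain p q where p: "p \<noteq> 0" "p * u \<in> {0, 1}" and q: "q \<noteq> 0" "q * v \<in> {0, 1}"
      using scale[of u] scale[of v] by blast
    have "hom_lie_isomorphic (*s) (r3_bracket z) ((*v) (r3_twist u v a b c))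
      (*s) (r3_bracket z) ((*v) (r3_twist (p * u) (q * v) 0 0 0))"
      unfolding iso using 1 p(1) q(1)
      by (intro exI[of _ 0] exI[of _ 0] exI[of _ p] exI[of _ q]) simp
    moreover have "normal_parameters (p * u) (q * v) 0 0 0"
      using p q by (auto simp: normal_parameters_def)
    ultimately show ?thesis by blast
  next
    case 2
    obtain q where q: "q \<noteq> 0" "q * v \<in> {0, 1}"
      using scale by blast
    have "hom_lie_isomorphic (*s) (r3_bracket z) ((*v) (r3_twist u v a b c))
      (*s) (r3_bracket z) ((*v) (r3_twist 0 (q * v) 0 1 0))"
      unfolding iso using 2 q(1)
      by (intro exI[of _ 0] exI[of _ "q / b * u"] exI[of _ "q / b"] exI[of _ q]) auto
    moreover have "normal_parameters 0 (q * v) 0 1 0"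
      using q by (auto simp: normal_parameters_def)
    ultimately show ?thesis by blast
  next
    case 3
    obtain p where p: "p \<noteq> 0" "p * u \<in> {0, 1}"
      using scale by blast
    have "hom_lie_isomorphic (*s) (r3_bracket z) ((*v) (r3_twist u v a b c))
      (*s) (r3_bracket z) ((*v) (r3_twist (p * u) 0 0 0 1))"
      unfolding iso using 3 p(1)
      by (intro exI[of _ "p / c * v"] exI[of _ 0] exI[of _ p] exI[of _ "p / c"]) auto
    moreover have "normal_parameters (p * u) 0 0 0 1"
      using p by (auto simp: normal_parameters_def)
    ultimately show ?thesis by blast
  next
    case 4
    \<comment> \<open>The target block has image spanned by \<open>(1, -1)\<close>, so the class of \<open>(p u, q v)\<close> is the sum of
      its coordinates; \<open>q / p = b / a\<close> is forced by the top right entry of the target block.\<close>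
    obtain p where p: "p \<noteq> 0" "p * (u + b / a * v) \<in> {0, 1}"
      using scale by blast
    define q where "q = p * b / a"
    have "b * c = - a\<^sup>2"
      using nil by (simp add: eq_neg_iff_add_eq_0 add.commute)
    moreover have "q * c = p * (b * c) / a"
      by (simp add: q_def)
    ultimately have "q * c = - a * p"
      using 4 by (simp add: power2_eq_square)
    moreover have "q \<noteq> 0" "p * b = a * q"
      using 4 p(1) by (simp_all add: q_def)
    moreover have "p * u = p * (u + b / a * v) + a * (- q * v / a) + a * 0"
      "q * v = 0 + - a * (- q * v / a) - a * 0"
      using 4 by (simp_all add: q_def algebra_simps)
    ultimately have "hom_lie_isomorphic (*s) (r3_bracket z) ((*v) (r3_twist u v a b c))
      (*s) (r3_bracket z) ((*v) (r3_twist (p * (u + b / a * v)) 0 a a (- a)))"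
      unfolding iso using 4 p(1)
      by blast
    moreover from p 4 have "normal_parameters (p * (u + b / a * v)) 0 a a (- a)"
      by (auto simp: normal_parameters_def)
    ultimately show ?thesis by blast
  qed
qed

text \<open>
  All normalised quantities other than \<open>a\<close> are determined by \<open>a\<close> and by which of them vanish; since
  automorphisms only rescale \<open>b\<close>, \<open>c\<close> and the class of \<open>(u, v)\<close>, the vanishing pattern is invariant.
\<close>
lemma normal_parameters_unique:
  assumes z: "z * (z\<^sup>2 - 1) \<noteq> 0"
    and normal: "normal_parameters u v a b c" "normal_parameters u' v' a' b' c'"
    and iso: "hom_lie_isomorphic (*s) (r3_bracket z) ((*v) (r3_twist u v a b c))
      (*s) (r3_bracket z) ((*v) (r3_twist u' v' a' b' c'))"
  shows "r3_twist u v a b c = r3_twist u' v' a' b' c'"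
proof -
  obtain s t p q where "p \<noteq> 0" "q \<noteq> 0" "a = a'"
    and u: "p * u = u' + a' * s + b' * t" and v: "q * v = v' + c' * s - a' * t"
    and b: "p * b = b' * q" and c: "q * c = c' * p"
    using iso unfolding hom_lie_isomorphic_r3_twist_iff[OF z] by blast
  from b \<open>p \<noteq> 0\<close> \<open>q \<noteq> 0\<close> have "b = 0 \<longleftrightarrow> b' = 0" by auto
  moreover from c \<open>p \<noteq> 0\<close> \<open>q \<noteq> 0\<close> have "c = 0 \<longleftrightarrow> c' = 0" by auto
  ultimately have block: "b = b'" "c = c'"
    using normal \<open>a = a'\<close> by (auto simp: normal_parameters_def)
  have "(u = 0 \<longleftrightarrow> u' = 0) \<and> (v = 0 \<longleftrightarrow> v' = 0)"
  proof (cases "a = 0")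
    case True
    with normal block u v \<open>a = a'\<close> \<open>p \<noteq> 0\<close> \<open>q \<noteq> 0\<close> show ?thesis
      by (auto simp: normal_parameters_def)
  next
    case False
    with normal block \<open>a = a'\<close> have "v = 0" "v' = 0" "b' = a'" "c' = - a'"
      by (auto simp: normal_parameters_def)
    with u v have "p * u = u'" by (simp add: algebra_simps)
    with \<open>p \<noteq> 0\<close> \<open>v = 0\<close> \<open>v' = 0\<close> show ?thesis by auto
  qed
  with normal have "u = u'" "v = v'"
    by (auto simp: normal_parameters_def)
  with block \<open>a = a'\<close> show ?thesis by simp
qed

theorem proposition3p4:
  fixes z :: complex
  assumes "z * (z^2 - 1) \<noteq> 0"
  shows "(\<forall>M \<in> twist_matrices. hom_lie_algebra (*s) (r3_bracket z) ((*v) M))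
    \<and> (\<forall>A :: complex^3 \<Rightarrow> complex^3.
        hom_lie_algebra (*s) (r3_bracket z) A \<and> nilpotent_operator A \<longrightarrow>
        (\<exists>M \<in> twist_matrices.
          hom_lie_isomorphic (*s) (r3_bracket z) A (*s) (r3_bracket z) ((*v) M)))
    \<and> (\<forall>M \<in> twist_matrices. \<forall>N \<in> twist_matrices.
        hom_lie_isomorphic (*s) (r3_bracket z) ((*v) M) (*s) (r3_bracket z) ((*v) N)
        \<longleftrightarrow> (*v) M = (*v) N)"
proof (intro conjI ballI allI impI)
  have "z \<noteq> 0" using assms by auto
  fix M :: "complex^3^3"
  assume "M \<in> twist_matrices"
  then show "hom_lie_algebra (*s) (r3_bracket z) ((*v) M)"
    unfolding hom_lie_r3_iff[OF \<open>z \<noteq> 0\<close>] twist_matrices_eq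
    by (auto simp: r3_twist_def)
next
  have "z \<noteq> 0" using assms by auto
  fix A :: "complex^3 \<Rightarrow> complex^3"
  assume A: "hom_lie_algebra (*s) (r3_bracket z) A \<and> nilpotent_operator A"
  have A_eq: "(*v) (matrix A) = A"
    using A matrix_works[of A] by (auto dest: hom_lie_algebra.linear_twist)
  have row: "matrix A $ 1 $ 2 = 0" "matrix A $ 1 $ 3 = 0"
    using A hom_lie_r3_iff[OF \<open>z \<noteq> 0\<close>, of "matrix A"] by (simp_all add: A_eq)
  have "nilpotent_operator ((*v) (matrix A))"
    using A by (simp add: A_eq)
  from nilpotent_r3_twist[OF row this] obtain u v a b c
    where M: "matrix A = r3_twist u v a b c" and nil: "a\<^sup>2 + b * c = 0" .
  from M A_eq have "A = (*v) (r3_twist u v a b c)"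
    by simp
  with isomorphic_to_normal_parameters[OF assms nil, of u v]
  obtain u' v' a' b' c' where "normal_parameters u' v' a' b' c'"
    "hom_lie_isomorphic (*s) (r3_bracket z) A
      (*s) (r3_bracket z) ((*v) (r3_twist u' v' a' b' c'))"
    by (elim exE conjE) simp
  then show "\<exists>M \<in> twist_matrices.
      hom_lie_isomorphic (*s) (r3_bracket z) A (*s) (r3_bracket z) ((*v) M)"
    unfolding twist_matrices_eq by blast
next
  fix M N :: "complex^3^3"
  assume MN: "M \<in> twist_matrices" "N \<in> twist_matrices"
  show "hom_lie_isomorphic (*s) (r3_bracket z) ((*v) M) (*s) (r3_bracket z) ((*v) N)
    \<longleftrightarrow> (*v) M = (*v) N"
  proof
    assume "hom_lie_isomorphic (*s) (r3_bracket z) ((*v) M) (*s) (r3_bracket z) ((*v) N)"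
    moreover obtain u v a b c u' v' a' b' c'
      where "M = r3_twist u v a b c" "normal_parameters u v a b c"
        and "N = r3_twist u' v' a' b' c'" "normal_parameters u' v' a' b' c'"
      using MN unfolding twist_matrices_eq by blast
    ultimately have "M = N"
      using normal_parameters_unique[OF assms] by blast
    then show "(*v) M = (*v) N" by simp
  next
    assume eq: "(*v) M = (*v) N"
    show "hom_lie_isomorphic (*s) (r3_bracket z) ((*v) M) (*s) (r3_bracket z) ((*v) N)"
      unfolding hom_lie_isomorphic_def eq by (intro exI[of _ id]) (simp add: vec.linear_id)
  qed
qed

end
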